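(* Let $d\ge 1$ and let $X$ and $X_{\mathbf n}$, $\mathbf n\in\mathbb Z_+^d$, be real-valued random variables on a probability space $(\Omega,\mathcal F,P)$ (no assumption is made on their dependence). Assume there is a constant $M>0$ such that $$\frac{1}{|\mathbf n|}\sum_{\mathbf k\preceq \mathbf n}P(|X_{\mathbf k}|>x)\le M\,P(|X|>x)\qquad\text{for all } x\ge 0 \text{ and all } \mathbf n\in\mathbb Z_+^d .$$ If $E\big[|X|(\log^+|X|)^{d}\big]<\infty$, then for every $\epsilon>0$ and for almost all $t\in\mathbb T^d$ (with respect to Lebesgue measure), $$\sum_{\mathbf n\in\mathbb Z_+^d}|\mathbf n|^{-1}\,P\big(|S_{\mathbf n}(t)|>\epsilon|\mathbf n|\big)<\infty .$$
   Context: $\mathbb Z_+^d$ is the set of $d$-dimensional lattice points with positive integer coordinates. For $\mathbf k,\mathbf n\in\mathbb Z_+^d$, $\mathbf k\preceq\mathbf n$ means $k_i\le n_i$ for all $1\le i\le d$, and $|\mathbf n|=n_1n_2\cdots n_d$. $\mathbb T=[-\pi,\pi)$. For $t=(t_1,\dots,t_d)\in\mathbb T^d$, $\mathbf k\cdot t=k_1t_1+\cdots+k_dt_d$, and the discrete Fourier transform is $S_{\mathbf n}(t)=\sum_{\mathbf k\preceq\mathbf n}e^{i\mathbf k\cdot t}X_{\mathbf k}$. The notation $\log^+x$ means $\max\{1,\log x\}$ (equal to $1$ at $x=0$). *)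

theory Defs
  imports "HOL-Probability.Probability"
begin

text \<open>
  Dimension d is \<open>CARD('d)\<close>. The order \<open>k \<le> n\<close> on \<open>nat ^ 'd\<close> is the library's componentwise order.
\<close>

definition pos_lattice :: "(nat ^ 'd) set" where
  "pos_lattice = {n. \<forall>i. 1 \<le> n $ i}"

definition lattice_size :: "nat ^ 'd \<Rightarrow> nat" where
  "lattice_size n = (\<Prod>i\<in>UNIV. n $ i)"

definition lattice_below :: "nat ^ 'd \<Rightarrow> (nat ^ 'd) set" where
  "lattice_below n = {k \<in> pos_lattice. k \<le> n}"

definition torus :: "(real ^ 'd) set" where
  "torus = {t. \<forall>i. - pi \<le> t $ i \<and> t $ i < pi}"

definition lattice_dot :: "nat ^ 'd \<Rightarrow> real ^ 'd \<Rightarrow> real" where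
  "lattice_dot k t = (\<Sum>i\<in>UNIV. real (k $ i) * t $ i)"

definition dft :: "(nat ^ 'd \<Rightarrow> 'a \<Rightarrow> real) \<Rightarrow> nat ^ 'd \<Rightarrow> real ^ 'd \<Rightarrow> 'a \<Rightarrow> complex" where
  "dft X n t \<omega> =
     (\<Sum>k\<in>lattice_below n. exp (\<i> * complex_of_real (lattice_dot k t)) * complex_of_real (X k \<omega>))"

text \<open>At \<open>x = 0\<close> this is \<open>1\<close>, since \<open>ln 0 = 0\<close> in the library.\<close>

definition log_plus :: "real \<Rightarrow> real" where
  "log_plus x = max 1 (ln x)"

end

theory Submission
  imports Defs
begin

text \<open>
  Truncate \<open>X\<^sub>k\<close> at the level \<open>|n|\<close>. The event \<open>|S\<^sub>n(t)| > \<epsilon> |n|\<close> forces either some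
  \<open>|X\<^sub>k| > |n|\<close> with \<open>k \<le> n\<close>, or the truncated transform to be large, and the latter is controlled by
  Chebyshev. Without any independence, orthogonality of the characters on the torus makes the
  \<open>t\<close>-integral of the second moment of the truncated transform equal to
  \<open>(2\<pi>)\<^sup>d\<close> times the sum of the truncated second moments. Layer-cake summation and the averaged tail
  hypothesis bound both contributions, integrated over \<open>t\<close> and weighted by \<open>1/|n|\<close>, by a constant times
  \<open>E (min 1 (Z/|n|))\<^sup>2\<close> with \<open>Z = |X| + 1\<close>. The sum of \<open>(min 1 (Z/|n|))\<^sup>2\<close> over the lattice is
  \<open>O(Z (log\<^sup>+ Z)\<^sup>d)\<close>, which has finite expectation, so the series converges for almost all \<open>t\<close>.
\<close>

subsection \<open>Orthogonality of characters on the cube\<close>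

text \<open>For \<open>m \<noteq> 0\<close> the antiderivative
  \<open>exp (\<i> m x) / (\<i> m)\<close> has period \<open>2 * pi\<close>, so its boundary values
  cancel. The case \<open>m = 0\<close> has the constant integrand 1 and is integrated
  separately.\<close>

lemma has_bochner_integral_exp_int_period:
  fixes m :: int
  shows "has_bochner_integral lborel
    (\<lambda>x. indicator {-pi..pi} x *\<^sub>R exp (\<i> * complex_of_real (of_int m * x)))
    (if m = 0 then 2 * pi else 0)"
proof (cases "m = 0")
  case True
  have "has_bochner_integral lborel (\<lambda>x. indicator {-pi..pi} x *\<^sub>R (1::complex)) (of_real pi - of_real (-pi))"
    by (rule has_bochner_integral_FTC_Icc)
      (auto intro!: derivative_eq_intros continuous_intros)
  with True show ?thesis by simp
next
  case False
  let ?F = "\<lambda>x. exp (\<i> * complex_of_real (of_int m * x)) / (\<i> * of_int m)"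
  have "has_bochner_integral lborel
    (\<lambda>x. indicator {-pi..pi} x *\<^sub>R exp (\<i> * complex_of_real (of_int m * x))) (?F pi - ?F (-pi))"
  proof (rule has_bochner_integral_FTC_Icc)
    fix x :: real
    have "((\<lambda>z. exp (\<i> * (of_int m * z)) / (\<i> * of_int m)) has_field_derivative
        exp (\<i> * (of_int m * complex_of_real x)) * (\<i> * of_int m) / (\<i> * of_int m)) (at (complex_of_real x))"
      using False by (intro DERIV_cdivide) (auto intro!: derivative_eq_intros)
    then have "((\<lambda>z. exp (\<i> * (of_int m * z)) / (\<i> * of_int m)) has_field_derivative
        exp (\<i> * (of_int m * complex_of_real x))) (at (complex_of_real x))"
      using False by simp
    then show "(?F has_vector_derivative exp (\<i> * complex_of_real (of_int m * x))) (at x within {-pi..pi})"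
      by (auto dest: has_vector_derivative_real_field)
  qed (auto intro!: continuous_intros)
  moreover have "exp (\<i> * complex_of_real (of_int m * pi)) = exp (\<i> * complex_of_real (of_int m * - pi))"
    by (subst exp_eq) (auto intro!: exI[of _ m] simp: algebra_simps)
  ultimately show ?thesis using False by simp
qed

text \<open>Lebesgue measure on \<open>real^'d\<close> is the image of a product measure under the
  coordinate map, so Fubini factorizes the integral of a product of functions of single
  coordinates.\<close>

lemma has_bochner_integral_lborel_prod_vec:
  fixes f :: "'d::finite \<Rightarrow> real \<Rightarrow> 'b::{real_normed_field, banach, second_countable_topology}"
  assumes int: "\<And>i. integrable lborel (f i)"
  shows "has_bochner_integral lborel (\<lambda>x::real^'d. \<Prod>i\<in>UNIV. f i (x $ i)) (\<Prod>i\<in>UNIV. integral\<^sup>L lborel (f i))"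
proof -
  interpret product_sigma_finite "\<lambda>b::real^'d. lborel :: real measure"
    by standard
  let ?M = "\<Pi>\<^sub>M b\<in>(Basis :: (real^'d) set). (lborel :: real measure)"
  let ?T = "\<lambda>g. \<Sum>b\<in>(Basis :: (real^'d) set). g b *\<^sub>R b"
  \<comment> \<open>The product measure is indexed by basis vectors and not by \<open>'d\<close>.
    The family \<open>f\<close> is transported along the injection
    \<open>i \<mapsto> axis i 1\<close>, which \<open>THE\<close> inverts.\<close>
  define h where "h b = f (THE i. b = axis i 1)" for b :: "real^'d"
  have h_axis: "h (axis i 1) = f i" for i
    by (auto simp: h_def axis_eq_axis)
  have Basis: "Basis = range (\<lambda>i::'d. axis i (1::real))"
    by (auto simp: Basis_vec_def)
  have inj: "inj (\<lambda>i::'d. axis i (1::real))"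
    by (auto simp: inj_on_def axis_eq_axis)
  have meas_f [measurable]: "f i \<in> borel_measurable borel" for i
    using int[of i] by (simp add: borel_measurable_integrable flip: measurable_lborel1)
  have comp: "?T g $ i = g (axis i 1)" for g i
    by (simp add: cart_eq_inner_axis)
  have eq: "(\<lambda>g. \<Prod>i\<in>UNIV. f i (?T g $ i)) = (\<lambda>g. \<Prod>b\<in>Basis. h b (g b))"
    unfolding comp by (auto simp: Basis prod.reindex[OF inj] h_axis)
  have int_h: "integrable lborel (h b)" if "b \<in> Basis" for b
    using that int by (auto simp: Basis h_axis)
  have meas: "?T \<in> measurable ?M borel"
    by measurable
  have meas_p: "(\<lambda>x::real^'d. \<Prod>i\<in>UNIV. f i (x $ i)) \<in> borel_measurable borel"
    by measurable
  have "integrable ?M (\<lambda>g. \<Prod>i\<in>UNIV. f i (?T g $ i))"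
    unfolding eq by (rule product_integrable_prod) (auto intro: int_h)
  then have 1: "integrable lborel (\<lambda>x::real^'d. \<Prod>i\<in>UNIV. f i (x $ i))"
    unfolding lborel_eq[where 'a="real^'d"] by (subst integrable_distr_eq[OF meas meas_p])
  have "integral\<^sup>L lborel (\<lambda>x::real^'d. \<Prod>i\<in>UNIV. f i (x $ i)) = (\<integral>g. (\<Prod>i\<in>UNIV. f i (?T g $ i)) \<partial>?M)"
    unfolding lborel_eq[where 'a="real^'d"] by (subst integral_distr[OF meas meas_p]) simp
  also have "\<dots> = (\<Prod>b\<in>Basis. integral\<^sup>L lborel (h b))"
    unfolding eq by (rule product_integral_prod) (auto intro: int_h)
  also have "\<dots> = (\<Prod>i\<in>UNIV. integral\<^sup>L lborel (f i))"
    by (simp add: Basis prod.reindex[OF inj] h_axis)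
  finally show ?thesis using 1 by (simp add: has_bochner_integral_iff)
qed

text \<open>The closed version of \<open>torus\<close>: it suits the fundamental theorem of calculus
  on closed intervals, and a bound for almost all \<open>t\<close> in it passes to the subset
  \<open>torus\<close>.\<close>

definition cube :: "(real^'d) set" where
  "cube = {t. \<forall>i. t $ i \<in> {-pi..pi}}"

lemma torus_subset_cube: "torus \<subseteq> cube"
  by (auto simp: torus_def cube_def intro: less_imp_le)

lemma cube_measurable [measurable]: "cube \<in> sets borel"
  unfolding cube_def by measurable

lemma indicator_cube: "indicator cube t = (\<Prod>i\<in>UNIV. indicator {-pi..pi} (t $ i) :: real)"
  by (auto simp: cube_def indicator_def)

lemma lattice_dot_measurable [measurable]: "lattice_dot k \<in> borel_measurable borel"
  unfolding lattice_dot_def by measurable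

text \<open>The integrand is the character of frequency \<open>k - l\<close>. Its integral is a
  product over the coordinates, and one coordinate in which \<open>k\<close> and \<open>l\<close>
  differ contributes a factor 0.\<close>

lemma character_orthogonality:
  fixes k l :: "nat^'d"
  shows "has_bochner_integral lborel
    (\<lambda>t. indicator cube t *\<^sub>R (exp (\<i> * complex_of_real (lattice_dot k t)) * cnj (exp (\<i> * complex_of_real (lattice_dot l t)))))
    (if k = l then of_real ((2 * pi) ^ CARD('d)) else 0)"
proof -
  \<comment> \<open>The difference is taken in \<open>int\<close>, since subtraction on
    \<open>nat\<close> would truncate.\<close>
  define m where "m i = int (k $ i) - int (l $ i)" for i
  let ?f = "\<lambda>i x. indicator {-pi..pi} x *\<^sub>R exp (\<i> * complex_of_real (of_int (m i) * x))"
  have m: "k = l \<longleftrightarrow> (\<forall>i. m i = 0)"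
    by (auto simp: m_def vec_eq_iff)
  have "has_bochner_integral lborel (\<lambda>t::real^'d. \<Prod>i\<in>UNIV. ?f i (t $ i)) (\<Prod>i\<in>UNIV. integral\<^sup>L lborel (?f i))"
    by (intro has_bochner_integral_lborel_prod_vec integrable.intros[OF has_bochner_integral_exp_int_period])
  also have "(\<Prod>i\<in>UNIV. integral\<^sup>L lborel (?f i)) = (\<Prod>i\<in>UNIV. if m i = 0 then 2 * pi else 0)"
    by (subst has_bochner_integral_integral_eq[OF has_bochner_integral_exp_int_period]) simp
  also have "\<dots> = (if k = l then of_real ((2 * pi) ^ CARD('d)) else 0)"
    by (auto simp: m)
  also have "(\<lambda>t::real^'d. \<Prod>i\<in>UNIV. ?f i (t $ i)) =
    (\<lambda>t. indicator cube t *\<^sub>R (exp (\<i> * complex_of_real (lattice_dot k t)) * cnj (exp (\<i> * complex_of_real (lattice_dot l t)))))"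
  proof
    fix t :: "real^'d"
    have "(\<Prod>i\<in>UNIV. ?f i (t $ i)) = indicator cube t *\<^sub>R exp (\<Sum>i\<in>UNIV. \<i> * complex_of_real (of_int (m i) * t $ i))"
      by (simp add: indicator_cube exp_sum prod.distrib scaleR_conv_of_real)
    also have "(\<Sum>i\<in>UNIV. \<i> * complex_of_real (of_int (m i) * t $ i)) =
        \<i> * complex_of_real (lattice_dot k t) + cnj (\<i> * complex_of_real (lattice_dot l t))"
      by (simp add: m_def lattice_dot_def sum_distrib_left algebra_simps sum_subtractf sum_negf)
    finally show "(\<Prod>i\<in>UNIV. ?f i (t $ i)) =
      indicator cube t *\<^sub>R (exp (\<i> * complex_of_real (lattice_dot k t)) * cnj (exp (\<i> * complex_of_real (lattice_dot l t))))"
      by (simp only: exp_add exp_cnj)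
  qed
  finally show ?thesis .
qed

text \<open>Expand the squared modulus into a double sum over \<open>k\<close> and \<open>l\<close>;
  orthogonality leaves the diagonal, each term of which carries the volume of the cube.\<close>

lemma parseval_cube:
  fixes K :: "(nat^'d) set" and a :: "nat^'d \<Rightarrow> real"
  assumes "finite K"
  shows "(\<integral>\<^sup>+t. ennreal (indicator cube t * (cmod (\<Sum>k\<in>K. exp (\<i> * complex_of_real (lattice_dot k t)) * of_real (a k)))\<^sup>2) \<partial>lborel)
    = ennreal ((2 * pi) ^ CARD('d) * (\<Sum>k\<in>K. (a k)\<^sup>2))"
proof -
  define e where "e k t = exp (\<i> * complex_of_real (lattice_dot k t))" for k :: "nat^'d" and t
  let ?g = "\<lambda>t. indicator cube t * (cmod (\<Sum>k\<in>K. e k t * of_real (a k)))\<^sup>2"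
  have "has_bochner_integral lborel
    (\<lambda>t. \<Sum>k\<in>K. \<Sum>l\<in>K. complex_of_real (a k * a l) * (indicator cube t *\<^sub>R (e k t * cnj (e l t))))
    (\<Sum>k\<in>K. \<Sum>l\<in>K. complex_of_real (a k * a l) * (if k = l then of_real ((2 * pi) ^ CARD('d)) else 0))"
    unfolding e_def
    by (intro has_bochner_integral_sum has_bochner_integral_mult_right character_orthogonality)
  also have "(\<lambda>t. \<Sum>k\<in>K. \<Sum>l\<in>K. complex_of_real (a k * a l) * (indicator cube t *\<^sub>R (e k t * cnj (e l t))))
     = (\<lambda>t. complex_of_real (?g t))"
    unfolding of_real_mult complex_norm_square
    by (simp add: sum_product scaleR_conv_of_real sum_distrib_left mult_ac)
      (intro ext, subst sum.swap, simp add: mult_ac)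
  also have "(\<Sum>k\<in>K. \<Sum>l\<in>K. complex_of_real (a k * a l) * (if k = l then of_real ((2 * pi) ^ CARD('d)) else 0))
     = complex_of_real ((2 * pi) ^ CARD('d) * (\<Sum>k\<in>K. (a k)\<^sup>2))"
    using assms by (simp add: if_distrib sum_distrib_left power2_eq_square mult_ac cong: if_cong)
  \<comment> \<open>The expansion is an identity of complex numbers; taking real parts returns to
    the real integrand.\<close>
  finally have "has_bochner_integral lborel (\<lambda>t. Re (complex_of_real (?g t))) (Re (complex_of_real ((2 * pi) ^ CARD('d) * (\<Sum>k\<in>K. (a k)\<^sup>2))))"
    by (rule has_bochner_integral_Re)
  then have "has_bochner_integral lborel ?g ((2 * pi) ^ CARD('d) * (\<Sum>k\<in>K. (a k)\<^sup>2))"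
    by (simp only: Re_complex_of_real)
  then show ?thesis
    by (auto simp: has_bochner_integral_iff nn_integral_eq_integral e_def)
qed

subsection \<open>Lattice sums\<close>

text \<open>For \<open>j \<ge> 2\<close> the term is at most
  \<open>((j-1) powr (-\<delta>) - j powr (-\<delta>)) / \<delta>\<close>, the integral of
  \<open>x powr (-(1+\<delta>))\<close> over \<open>[j-1, j]\<close>. These differences telescope,
  and keeping the last one makes the induction close.\<close>

lemma sum_powr_le_telescope:
  fixes \<delta> :: real
  assumes "\<delta> > 0"
  shows "(\<Sum>j=1..Suc N. real j powr (-(1+\<delta>))) \<le> 1 + 1/\<delta> - real (Suc N) powr (-\<delta>) / \<delta>"
proof (induction N)
  case 0
  show ?case by simp
next
  case (Suc N)
  define x where "x = real (Suc (Suc N))"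
  have x: "x > 1" by (simp add: x_def)
  have "ln (1 - 1/x) \<le> - (1/x)"
    using ln_add_one_self_le_self2[of "-(1/x)"] x by simp
  moreover have "ln (1 - 1/x) = ln (x - 1) - ln x"
  proof -
    have "1 - 1/x = (x - 1)/x" using x by (simp add: field_simps)
    then show ?thesis using x by (simp add: ln_div)
  qed
  ultimately have "1/x \<le> ln x - ln (x - 1)" by simp
  \<comment> \<open>Elementary replacement for the integral comparison:
    \<open>1 + u \<le> exp u\<close> gives
    \<open>1 + \<delta>/x \<le> (x/(x-1)) powr \<delta>\<close>.\<close>
  then have "1 + \<delta>/x \<le> 1 + \<delta> * (ln x - ln (x - 1))"
    using assms mult_left_mono[of "1/x" "ln x - ln (x - 1)" \<delta>] by simp
  also have "\<dots> \<le> exp (\<delta> * (ln x - ln (x - 1)))"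
    by (rule exp_ge_add_one_self)
  finally have "(1 + \<delta>/x) * x powr (-\<delta>) \<le> exp (\<delta> * (ln x - ln (x - 1))) * x powr (-\<delta>)"
    by (rule mult_right_mono) simp
  also have "\<dots> = (x - 1) powr (-\<delta>)"
    using x by (simp add: powr_def exp_add[symmetric] algebra_simps)
  finally have "\<delta> * (x powr (-\<delta>) / x) \<le> (x - 1) powr (-\<delta>) - x powr (-\<delta>)"
    by (simp add: algebra_simps)
  moreover have "x powr (-(1+\<delta>)) = x powr (-\<delta>) / x"
    using x powr_diff[of x "-\<delta>" 1] by (simp add: minus_diff_commute)
  ultimately have "\<delta> * x powr (-(1+\<delta>)) \<le> (x - 1) powr (-\<delta>) - x powr (-\<delta>)"
    by simp
  then have "x powr (-(1+\<delta>)) \<le> (x - 1) powr (-\<delta>) / \<delta> - x powr (-\<delta>) / \<delta>"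
    using assms by (simp add: field_simps)
  moreover have "x - 1 = real (Suc N)" by (simp add: x_def)
  ultimately show ?case
    using Suc by (simp add: x_def)
qed

lemma sum_powr_le:
  fixes \<delta> :: real
  assumes "\<delta> > 0"
  shows "(\<Sum>j=1..N. real j powr (-(1+\<delta>))) \<le> 1 + 1/\<delta>"
proof (cases N)
  case 0
  then show ?thesis using assms by simp
next
  case (Suc m)
  have "0 \<le> real (Suc m) powr (-\<delta>) / \<delta>" using assms by simp
  with sum_powr_le_telescope[OF assms, of m] show ?thesis
    unfolding Suc by linarith
qed

lemma lattice_size_pos: "n \<in> pos_lattice \<Longrightarrow> 0 < lattice_size n"
  by (auto simp: pos_lattice_def lattice_size_def Suc_le_eq intro!: prod_pos)

lemma finite_lattice_box: "finite {n :: nat^'d. \<forall>i. n $ i \<in> {1..N}}"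
proof -
  have "{n :: nat^'d. \<forall>i. n $ i \<in> {1..N}} \<subseteq> vec_lambda ` (UNIV \<rightarrow>\<^sub>E {1..N})"
  proof
    fix n :: "nat^'d" assume "n \<in> {n. \<forall>i. n $ i \<in> {1..N}}"
    then have "n = vec_lambda (vec_nth n)" "vec_nth n \<in> UNIV \<rightarrow>\<^sub>E {1..N}" by auto
    then show "n \<in> vec_lambda ` (UNIV \<rightarrow>\<^sub>E {1..N})" by blast
  qed
  then show ?thesis by (rule finite_subset) (auto intro!: finite_PiE)
qed

lemma finite_lattice_below: "finite (lattice_below n)"
proof (rule finite_subset[OF _ finite_lattice_box])
  show "lattice_below n \<subseteq> {k. \<forall>i. k $ i \<in> {1..Max (range (vec_nth n))}}"
    by (auto simp: lattice_below_def pos_lattice_def less_eq_vec_def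
        intro: order_trans[OF _ Max_ge[OF _ rangeI]])
qed

text \<open>Enlarge \<open>F\<close> to a box. There the sum of products over all lattice points is
  the product of \<open>CARD('d)\<close> equal one-dimensional sums. The bound is independent of
  \<open>F\<close>.\<close>

lemma sum_lattice_size_powr_le:
  fixes F :: "(nat^'d) set"
  assumes "finite F" "F \<subseteq> pos_lattice" "\<delta> > 0"
  shows "(\<Sum>n\<in>F. real (lattice_size n) powr (-(1+\<delta>))) \<le> (1 + 1/\<delta>) ^ CARD('d)"
proof -
  \<comment> \<open>Inserting 0 keeps \<open>Max\<close> meaningful when \<open>F\<close> is
    empty.\<close>
  define N where "N = Max (insert 0 ((\<lambda>(n,i). n $ i) ` (F \<times> UNIV)))"
  let ?B = "{n :: nat^'d. \<forall>i. n $ i \<in> {1..N}}"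
  have "n $ i \<le> N" if "n \<in> F" for n i
    unfolding N_def using assms(1) that by (intro Max_ge) force+
  with assms(2) have sub: "F \<subseteq> ?B"
    by (auto simp: pos_lattice_def)
  have bij: "bij_betw vec_lambda ((UNIV :: 'd set) \<rightarrow>\<^sub>E {1..N}) ?B"
    by (rule bij_betwI[where g = vec_nth]) auto
  have powr_prod: "real (lattice_size (vec_lambda g)) powr s = (\<Prod>i\<in>UNIV. real (g i) powr s)"
    for g :: "'d \<Rightarrow> nat" and s
    by (simp add: lattice_size_def prod_powr_distrib)
  have "(\<Sum>n\<in>F. real (lattice_size n) powr (-(1+\<delta>))) \<le> (\<Sum>n\<in>?B. real (lattice_size n) powr (-(1+\<delta>)))"
    using sub finite_lattice_box by (intro sum_mono2) auto
  also have "\<dots> = (\<Sum>g\<in>(UNIV :: 'd set) \<rightarrow>\<^sub>E {1..N}. \<Prod>i\<in>UNIV. real (g i) powr (-(1+\<delta>)))"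
    by (subst sum.reindex_bij_betw[OF bij, symmetric]) (simp only: powr_prod)
  also have "\<dots> = (\<Prod>i\<in>(UNIV::'d set). \<Sum>j=1..N. real j powr (-(1+\<delta>)))"
    by (rule prod_sum_PiE[symmetric]) auto
  also have "\<dots> = (\<Sum>j=1..N. real j powr (-(1+\<delta>))) ^ CARD('d)"
    by simp
  also have "\<dots> \<le> (1 + 1/\<delta>) ^ CARD('d)"
    by (intro power_mono sum_powr_le sum_nonneg assms) auto
  finally show ?thesis .
qed

section \<open>Logarithmic weights and the lattice sum of truncated squares\<close>

lemma log_plus_ge_1: "1 \<le> log_plus x"
  by (simp add: log_plus_def)

lemma powr_inverse_log_plus_le: "z \<ge> 1 \<Longrightarrow> z powr (1 / log_plus z) \<le> exp 1"
  using log_plus_ge_1[of z] by (auto simp: powr_def log_plus_def field_simps)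

text \<open>Rankin's trick: the square is dominated by the power \<open>1 + \<delta>\<close>, whose sum over the lattice
  factorizes; \<open>\<delta> = 1 / log_plus z\<close> keeps \<open>z powr \<delta>\<close> bounded.\<close>

lemma sum_lattice_min_square_le:
  fixes F :: "(nat^'d) set"
  assumes "finite F" "F \<subseteq> pos_lattice" "z \<ge> 1"
  shows "(\<Sum>n\<in>F. (min 1 (z / real (lattice_size n)))\<^sup>2) \<le> exp 1 * 2 ^ CARD('d) * (z * log_plus z ^ CARD('d))"
proof -
  define \<delta> where "\<delta> = 1 / log_plus z"
  have \<delta>: "0 < \<delta>" "\<delta> \<le> 1" "1/\<delta> = log_plus z"
    using log_plus_ge_1[of z] by (auto simp: \<delta>_def)
  have "(min 1 (z / real (lattice_size n)))\<^sup>2 \<le> z powr (1+\<delta>) * real (lattice_size n) powr (-(1+\<delta>))"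
    if "n \<in> F" for n
  proof -
    have n: "real (lattice_size n) > 0"
      using lattice_size_pos assms(2) that by auto
    let ?u = "z / real (lattice_size n)"
    have u: "?u > 0" using n assms(3) by simp
    have "(min 1 ?u)\<^sup>2 = (min 1 ?u) powr 2"
      using u by (simp add: powr_numeral)
    \<comment> \<open>The base lies in \<open>(0, 1]\<close>, so lowering the exponent from 2 to
      \<open>1+\<delta>\<close> increases the power.\<close>
    also have "\<dots> \<le> (min 1 ?u) powr (1+\<delta>)"
      using u \<delta> by (intro powr_mono') auto
    also have "\<dots> \<le> ?u powr (1+\<delta>)"
      using u \<delta> by (intro powr_mono2) auto
    also have "\<dots> = z powr (1+\<delta>) * real (lattice_size n) powr (-(1+\<delta>))"
      unfolding powr_minus_divide using n assms(3) by (simp add: powr_divide)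
    finally show ?thesis .
  qed
  then have "(\<Sum>n\<in>F. (min 1 (z / real (lattice_size n)))\<^sup>2) \<le> z powr (1+\<delta>) * (\<Sum>n\<in>F. real (lattice_size n) powr (-(1+\<delta>)))"
    unfolding sum_distrib_left by (rule sum_mono)
  also have "\<dots> \<le> z powr (1+\<delta>) * (1 + 1/\<delta>) ^ CARD('d)"
    by (intro mult_left_mono sum_lattice_size_powr_le assms \<delta>) auto
  \<comment> \<open>Here \<open>z powr \<delta> \<le> exp 1\<close>, and
    \<open>1 + 1/\<delta> = 1 + log_plus z \<le> 2 * log_plus z\<close> because
    \<open>log_plus z \<ge> 1\<close>.\<close>
  also have "\<dots> \<le> (z * exp 1) * (2 * log_plus z) ^ CARD('d)"
    using powr_inverse_log_plus_le[of z] log_plus_ge_1[of z] assms(3) \<delta>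
    by (intro mult_mono power_mono) (auto simp: powr_add \<delta>_def)
  finally show ?thesis
    by (simp add: power_mult_distrib mult_ac)
qed

lemma log_plus_add_one_le:
  assumes "y \<ge> 0"
  shows "log_plus (y + 1) \<le> 2 * log_plus y"
proof -
  have ln2: "ln 2 \<le> (1::real)" using ln_le_minus_one[of 2] by simp
  show ?thesis
  proof (cases "y \<le> 1")
    case True
    have "ln (y + 1) \<le> ln 2" using True assms by simp
    with ln2 show ?thesis by (simp add: log_plus_def)
  next
    case False
    have "ln (y + 1) \<le> ln (2 * y)" using False by simp
    also have "\<dots> = ln 2 + ln y" using False by (simp add: ln_mult)
    finally show ?thesis using ln2 by (auto simp: log_plus_def)
  qed
qed

text \<open>Lets the moment assumption on \<open>y = |X|\<close> control the shifted variable
  \<open>y + 1\<close>, to which the lattice estimate applies since it is at least 1. The additive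
  constant is harmless on a probability space.\<close>

lemma add_one_log_plus_power_le:
  assumes "y \<ge> 0"
  shows "(y + 1) * log_plus (y + 1) ^ d \<le> 2 ^ d * (2 * (y * log_plus y ^ d) + 1)"
proof -
  have L: "log_plus y ^ d \<ge> 1"
    by (simp add: log_plus_ge_1)
  \<comment> \<open>For \<open>y \<le> 1\<close> the left side equals 1; for \<open>y > 1\<close>
    multiplication by \<open>y\<close> only enlarges it.\<close>
  have "log_plus y ^ d \<le> 1 + y * log_plus y ^ d"
  proof (cases "y \<le> 1")
    case True
    then have "log_plus y = 1"
      using assms by (cases "y = 0") (auto simp: log_plus_def intro!: max_absorb1 order_trans[OF ln_le_minus_one])
    then show ?thesis using assms by simp
  next
    case False
    then have "1 * log_plus y ^ d \<le> y * log_plus y ^ d"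
      using L by (intro mult_right_mono) auto
    then show ?thesis by simp
  qed
  then have "(y + 1) * log_plus y ^ d \<le> 2 * (y * log_plus y ^ d) + 1"
    by (simp add: algebra_simps)
  then have *: "2 ^ d * ((y + 1) * log_plus y ^ d) \<le> 2 ^ d * (2 * (y * log_plus y ^ d) + 1)"
    by (rule mult_left_mono) simp
  have "(y + 1) * log_plus (y + 1) ^ d \<le> (y + 1) * (2 * log_plus y) ^ d"
    using assms log_plus_ge_1[of "y+1"] log_plus_add_one_le[OF assms]
    by (intro mult_left_mono power_mono) auto
  also have "\<dots> = 2 ^ d * ((y + 1) * log_plus y ^ d)"
    by (simp add: power_mult_distrib)
  also note *
  finally show ?thesis .
qed

subsection \<open>Truncated moments\<close>

lemma summable_on_iff_nn_integral_count_space: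
  fixes f :: "'i \<Rightarrow> real"
  assumes "\<And>i. i \<in> I \<Longrightarrow> f i \<ge> 0"
  shows "f summable_on I \<longleftrightarrow> (\<integral>\<^sup>+i. ennreal (f i) \<partial>count_space I) < \<infinity>"
proof -
  have "f summable_on I \<longleftrightarrow> (\<lambda>i. norm (f i)) summable_on I"
    using assms by (intro summable_on_cong) simp
  also have "\<dots> \<longleftrightarrow> integrable (count_space I) f"
    unfolding abs_summable_equivalent by (simp add: Infinite_Set_Sum.abs_summable_on_def)
  also have "\<dots> \<longleftrightarrow> (\<integral>\<^sup>+i. ennreal (norm (f i)) \<partial>count_space I) < \<infinity>"
    by (simp add: integrable_iff_bounded)
  also have "(\<integral>\<^sup>+i. ennreal (norm (f i)) \<partial>count_space I) = (\<integral>\<^sup>+i. ennreal (f i) \<partial>count_space I)"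
    using assms by (intro nn_integral_cong) simp
  finally show ?thesis .
qed

text \<open>By Tonelli the integral of the pointwise sum is at most the sum of the
  \<open>c i\<close>; a nonnegative function with finite integral is finite almost
  everywhere.\<close>

lemma AE_summable_on:
  fixes f :: "'i \<Rightarrow> 'a \<Rightarrow> real"
  assumes "countable I"
    and meas [measurable]: "\<And>i. i \<in> I \<Longrightarrow> f i \<in> borel_measurable N"
    and nonneg: "\<And>i x. i \<in> I \<Longrightarrow> 0 \<le> f i x"
    and bound: "\<And>i. i \<in> I \<Longrightarrow> (\<integral>\<^sup>+x. ennreal (f i x) \<partial>N) \<le> ennreal (c i)"
    and c: "\<And>i. i \<in> I \<Longrightarrow> 0 \<le> c i" "c summable_on I"
  shows "AE x in N. (\<lambda>i. f i x) summable_on I"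
proof -
  \<comment> \<open>Countability of \<open>I\<close> supplies both sigma-finiteness and joint
    measurability.\<close>
  interpret sigma_finite_measure "count_space I"
    by (rule sigma_finite_measure_count_space_countable) fact
  have "(\<lambda>(i, x). ennreal (f i x)) \<in> borel_measurable (count_space I \<Otimes>\<^sub>M N)"
    by (rule measurable_pair_measure_countable1) (use assms(1) in auto)
  then have meas_sum: "(\<lambda>x. \<integral>\<^sup>+i. ennreal (f i x) \<partial>count_space I) \<in> borel_measurable N"
    by (intro borel_measurable_nn_integral) (simp add: measurable_pair_swap_iff[where ?M1.0 = N])
  have "(\<integral>\<^sup>+x. \<integral>\<^sup>+i. ennreal (f i x) \<partial>count_space I \<partial>N) = (\<integral>\<^sup>+i. \<integral>\<^sup>+x. ennreal (f i x) \<partial>N \<partial>count_space I)"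
    by (rule nn_integral_count_space_nn_integral) (use assms in auto)
  also have "\<dots> \<le> (\<integral>\<^sup>+i. ennreal (c i) \<partial>count_space I)"
    by (rule nn_integral_mono) (simp add: bound)
  also have "\<dots> < \<infinity>"
    using c by (subst summable_on_iff_nn_integral_count_space[symmetric])
  finally have "AE x in N. (\<integral>\<^sup>+i. ennreal (f i x) \<partial>count_space I) \<noteq> \<infinity>"
    by (intro nn_integral_noteq_infinite meas_sum) simp
  then show ?thesis
    by eventually_elim (simp add: summable_on_iff_nn_integral_count_space nonneg less_top)
qed

text \<open>Discrete layer cake for squares: the naturals below \<open>y\<close> are those below
  \<open>nat \<lceil>y\<rceil>\<close>, and the first \<open>m\<close> odd numbers add up to the
  square of \<open>m\<close>.\<close>

lemma sum_odd_below:
  fixes y :: real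
  shows "(\<Sum>j<N. (2 * real j + 1) * of_bool (real j < y)) = (real (min N (nat \<lceil>y\<rceil>)))\<^sup>2"
proof -
  have sq: "(\<Sum>j<m. 2 * real j + 1) = (real m)\<^sup>2" for m
    by (induction m) (auto simp: power2_eq_square algebra_simps)
  have "real j < y \<longleftrightarrow> j < nat \<lceil>y\<rceil>" for j
    by linarith
  then have "(\<Sum>j<N. (2 * real j + 1) * of_bool (real j < y)) = (\<Sum>j<N. if j < nat \<lceil>y\<rceil> then 2 * real j + 1 else 0)"
    by (intro sum.cong) auto
  also have "\<dots> = (\<Sum>j<min N (nat \<lceil>y\<rceil>). 2 * real j + 1)"
    by (subst sum.If_cases) (auto intro!: sum.cong)
  finally show ?thesis by (simp add: sq)
qed

section \<open>Second moments expressed by tails, and their sums over the lattice\<close>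

context prob_space
begin

lemma sum_odd_prob_eq:
  assumes [measurable]: "Y \<in> borel_measurable M"
  shows "(\<Sum>j<N. (2 * real j + 1) * \<P>(\<omega> in M. \<bar>Y \<omega>\<bar> > real j)) =
    expectation (\<lambda>\<omega>. (real (min N (nat \<lceil>\<bar>Y \<omega>\<bar>\<rceil>)))\<^sup>2)"
proof -
  have "(\<Sum>j<N. (2 * real j + 1) * \<P>(\<omega> in M. \<bar>Y \<omega>\<bar> > real j)) =
     expectation (\<lambda>\<omega>. \<Sum>j<N. (2 * real j + 1) * indicator {\<omega> \<in> space M. \<bar>Y \<omega>\<bar> > real j} \<omega>)"
    by (subst Bochner_Integration.integral_sum)
      (auto intro!: integrable_mult_right integrable_real_indicator simp: less_top[symmetric])
  also have "\<dots> = expectation (\<lambda>\<omega>. (real (min N (nat \<lceil>\<bar>Y \<omega>\<bar>\<rceil>)))\<^sup>2)"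
    by (intro Bochner_Integration.integral_cong)
      (auto simp: sum_odd_below[symmetric] intro!: sum.cong)
  finally show ?thesis .
qed

text \<open>Bounds a moment by a nonnegative combination of tail probabilities, the form in which an
  averaged tail bound can be inserted level by level.\<close>

lemma truncated_second_moment_le:
  assumes [measurable]: "Y \<in> borel_measurable M"
  shows "expectation (\<lambda>\<omega>. (Y \<omega> * of_bool (\<bar>Y \<omega>\<bar> \<le> real N))\<^sup>2) \<le> (\<Sum>j<N. (2 * real j + 1) * \<P>(\<omega> in M. \<bar>Y \<omega>\<bar> > real j))"
  unfolding sum_odd_prob_eq[OF assms]
proof (rule integral_mono)
  show "integrable M (\<lambda>\<omega>. (Y \<omega> * of_bool (\<bar>Y \<omega>\<bar> \<le> real N))\<^sup>2)"
    by (rule integrable_const_bound[of _ "(real N)\<^sup>2"])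
      (auto intro!: AE_I2 simp: abs_le_square_iff[symmetric] power_mult_distrib)
  show "integrable M (\<lambda>\<omega>. (real (min N (nat \<lceil>\<bar>Y \<omega>\<bar>\<rceil>)))\<^sup>2)"
    by (rule integrable_const_bound[of _ "(real N)\<^sup>2"]) (auto intro!: AE_I2 power_mono)
  fix \<omega>
  show "(Y \<omega> * of_bool (\<bar>Y \<omega>\<bar> \<le> real N))\<^sup>2 \<le> (real (min N (nat \<lceil>\<bar>Y \<omega>\<bar>\<rceil>)))\<^sup>2"
  proof (cases "\<bar>Y \<omega>\<bar> \<le> real N")
    case True
    then have "\<bar>Y \<omega>\<bar> \<le> real (min N (nat \<lceil>\<bar>Y \<omega>\<bar>\<rceil>))" by linarith
    then have "\<bar>Y \<omega>\<bar>\<^sup>2 \<le> (real (min N (nat \<lceil>\<bar>Y \<omega>\<bar>\<rceil>)))\<^sup>2"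
      by (intro power_mono) auto
    then show ?thesis using True by simp
  qed simp
qed

text \<open>The way back from tails to a moment. Rounding up costs at most 1, which is the origin of
  the shift \<open>|Y| + 1\<close>.\<close>

lemma sum_odd_prob_le:
  assumes [measurable]: "Y \<in> borel_measurable M"
  shows "(\<Sum>j<N. (2 * real j + 1) * \<P>(\<omega> in M. \<bar>Y \<omega>\<bar> > real j)) \<le> expectation (\<lambda>\<omega>. (min (real N) (\<bar>Y \<omega>\<bar> + 1))\<^sup>2)"
  unfolding sum_odd_prob_eq[OF assms]
proof (rule integral_mono)
  show "integrable M (\<lambda>\<omega>. (min (real N) (\<bar>Y \<omega>\<bar> + 1))\<^sup>2)"
    by (rule integrable_const_bound[of _ "(real N)\<^sup>2"]) (auto intro!: AE_I2 power_mono)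
  show "integrable M (\<lambda>\<omega>. (real (min N (nat \<lceil>\<bar>Y \<omega>\<bar>\<rceil>)))\<^sup>2)"
    by (rule integrable_const_bound[of _ "(real N)\<^sup>2"]) (auto intro!: AE_I2 power_mono)
  show "(real (min N (nat \<lceil>\<bar>Y \<omega>\<bar>\<rceil>)))\<^sup>2 \<le> (min (real N) (\<bar>Y \<omega>\<bar> + 1))\<^sup>2" for \<omega>
    by (intro power_mono) linarith+
qed

text \<open>Finite partial sums commute with expectation, and the pointwise lattice estimate at
  \<open>z = |Y| + 1\<close> bounds all of them by one integrable function.\<close>

lemma summable_expectation_min_square:
  fixes Y :: "'a \<Rightarrow> real"
  assumes [measurable]: "Y \<in> borel_measurable M"
    and int: "integrable M (\<lambda>\<omega>. \<bar>Y \<omega>\<bar> * log_plus \<bar>Y \<omega>\<bar> ^ CARD('d))"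
  shows "(\<lambda>n :: nat^'d. expectation (\<lambda>\<omega>. (min 1 ((\<bar>Y \<omega>\<bar> + 1) / real (lattice_size n)))\<^sup>2)) summable_on pos_lattice"
proof (rule nonneg_bdd_above_summable_on)
  let ?q = "\<lambda>(n :: nat^'d) \<omega>. (min 1 ((\<bar>Y \<omega>\<bar> + 1) / real (lattice_size n)))\<^sup>2"
  let ?C = "exp 1 * 2 ^ CARD('d) :: real"
  let ?b = "\<lambda>\<omega>. ?C * (2 ^ CARD('d) * (2 * (\<bar>Y \<omega>\<bar> * log_plus \<bar>Y \<omega>\<bar> ^ CARD('d)) + 1))"
  show "0 \<le> expectation (?q n)" for n
    by (rule Bochner_Integration.integral_nonneg) simp
  have q_int: "integrable M (?q n)" for n
    by (rule integrable_const_bound[of _ 1]) (auto intro!: AE_I2 power_le_one)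
  show "bdd_above (sum (\<lambda>n. expectation (?q n)) ` {F. F \<subseteq> pos_lattice \<and> finite F})"
  proof (rule bdd_aboveI2)
    fix F :: "(nat^'d) set" assume F: "F \<in> {F. F \<subseteq> pos_lattice \<and> finite F}"
    have "(\<Sum>n\<in>F. expectation (?q n)) = expectation (\<lambda>\<omega>. \<Sum>n\<in>F. ?q n \<omega>)"
      by (rule Bochner_Integration.integral_sum[symmetric]) (rule q_int)
    also have "\<dots> \<le> expectation ?b"
    proof (rule integral_mono)
      show "integrable M (\<lambda>\<omega>. \<Sum>n\<in>F. ?q n \<omega>)"
        by (intro Bochner_Integration.integrable_sum q_int)
      show "integrable M ?b"
        by (intro integrable_mult_right Bochner_Integration.integrable_add int integrable_const)
      fix \<omega>
      have "(\<Sum>n\<in>F. ?q n \<omega>) \<le> ?C * ((\<bar>Y \<omega>\<bar> + 1) * log_plus (\<bar>Y \<omega>\<bar> + 1) ^ CARD('d))"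
        using F by (intro sum_lattice_min_square_le) auto
      also have "\<dots> \<le> ?b \<omega>"
        by (intro mult_left_mono add_one_log_plus_power_le) auto
      finally show "(\<Sum>n\<in>F. ?q n \<omega>) \<le> ?b \<omega>" .
    qed
    finally show "(\<Sum>n\<in>F. expectation (?q n)) \<le> expectation ?b" .
  qed
qed

text \<open>Tonelli moves the \<open>t\<close>-integral inside, where Parseval applies for each
  fixed \<open>\<omega>\<close> and removes the cross terms before any expectation is taken. The
  bound \<open>B\<close> makes all second moments finite.\<close>

lemma nn_integral_cube_second_moment:
  fixes K :: "(nat^'d) set" and Y :: "nat^'d \<Rightarrow> 'a \<Rightarrow> real"
  assumes K: "finite K"
    and [measurable]: "\<And>k. k \<in> K \<Longrightarrow> Y k \<in> borel_measurable M"
    and bdd: "\<And>k \<omega>. k \<in> K \<Longrightarrow> \<bar>Y k \<omega>\<bar> \<le> B"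
  defines "S \<equiv> \<lambda>t \<omega>. \<Sum>k\<in>K. exp (\<i> * complex_of_real (lattice_dot k t)) * of_real (Y k \<omega>)"
  shows "(\<lambda>t. expectation (\<lambda>\<omega>. (cmod (S t \<omega>))\<^sup>2)) \<in> borel_measurable borel"
    and "integrable M (\<lambda>\<omega>. (cmod (S t \<omega>))\<^sup>2)"
    and "(\<integral>\<^sup>+t. ennreal (indicator cube t * expectation (\<lambda>\<omega>. (cmod (S t \<omega>))\<^sup>2)) \<partial>lborel)
      = ennreal ((2 * pi) ^ CARD('d) * (\<Sum>k\<in>K. expectation (\<lambda>\<omega>. (Y k \<omega>)\<^sup>2)))"
proof -
  interpret PS: pair_sigma_finite "lborel :: (real^'d) measure" M ..
  have S_meas [measurable]: "(\<lambda>(t, \<omega>). S t \<omega>) \<in> borel_measurable (borel \<Otimes>\<^sub>M M)"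
    unfolding S_def by measurable
  show "(\<lambda>t. expectation (\<lambda>\<omega>. (cmod (S t \<omega>))\<^sup>2)) \<in> borel_measurable borel"
    by measurable
  have S_bound: "cmod (S t \<omega>) \<le> (\<Sum>k\<in>K. \<bar>B\<bar>)" for t \<omega>
    unfolding S_def
  proof (rule order_trans[OF norm_sum sum_mono])
    fix k assume "k \<in> K"
    with bdd[of k \<omega>] show "cmod (exp (\<i> * complex_of_real (lattice_dot k t)) * of_real (Y k \<omega>)) \<le> \<bar>B\<bar>"
      by (simp add: norm_mult)
  qed
  have S_meas1 [measurable]: "S t \<in> borel_measurable M" for t
    unfolding S_def by measurable
  show S_int: "integrable M (\<lambda>\<omega>. (cmod (S t \<omega>))\<^sup>2)" for t
    by (rule integrable_const_bound[of _ "(\<Sum>k\<in>K. \<bar>B\<bar>)\<^sup>2"])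
      (auto intro!: AE_I2 power_mono S_bound simp del: sum_constant)
  have Y_int: "integrable M (\<lambda>\<omega>. (Y k \<omega>)\<^sup>2)" if "k \<in> K" for k
    using that bdd[of k]
    by (intro integrable_const_bound[of _ "B\<^sup>2"]) (auto intro!: AE_I2 abs_le_square_iff[THEN iffD1] intro: order_trans[OF _ abs_ge_self])
  have "(\<integral>\<^sup>+t. ennreal (indicator cube t * expectation (\<lambda>\<omega>. (cmod (S t \<omega>))\<^sup>2)) \<partial>lborel)
     = (\<integral>\<^sup>+t. \<integral>\<^sup>+\<omega>. ennreal (indicator cube t * (cmod (S t \<omega>))\<^sup>2) \<partial>M \<partial>lborel)"
    using S_int
    by (intro nn_integral_cong)
      (simp add: nn_integral_eq_integral)
  also have "\<dots> = (\<integral>\<^sup>+\<omega>. \<integral>\<^sup>+t. ennreal (indicator cube t * (cmod (S t \<omega>))\<^sup>2) \<partial>lborel \<partial>M)"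
    by (rule PS.Fubini'[symmetric]) measurable
  also have "\<dots> = (\<integral>\<^sup>+\<omega>. ennreal ((2 * pi) ^ CARD('d) * (\<Sum>k\<in>K. (Y k \<omega>)\<^sup>2)) \<partial>M)"
    unfolding S_def by (simp add: parseval_cube[OF K])
  also have "\<dots> = ennreal (expectation (\<lambda>\<omega>. (2 * pi) ^ CARD('d) * (\<Sum>k\<in>K. (Y k \<omega>)\<^sup>2)))"
    by (rule nn_integral_eq_integral)
      (auto intro!: integrable_mult_right Bochner_Integration.integrable_sum Y_int AE_I2
        mult_nonneg_nonneg sum_nonneg)
  also have "expectation (\<lambda>\<omega>. (2 * pi) ^ CARD('d) * (\<Sum>k\<in>K. (Y k \<omega>)\<^sup>2))
     = (2 * pi) ^ CARD('d) * (\<Sum>k\<in>K. expectation (\<lambda>\<omega>. (Y k \<omega>)\<^sup>2))"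
    by (simp add: Bochner_Integration.integral_sum Y_int)
  finally show "(\<integral>\<^sup>+t. ennreal (indicator cube t * expectation (\<lambda>\<omega>. (cmod (S t \<omega>))\<^sup>2)) \<partial>lborel)
      = ennreal ((2 * pi) ^ CARD('d) * (\<Sum>k\<in>K. expectation (\<lambda>\<omega>. (Y k \<omega>)\<^sup>2)))" .
qed

end

section \<open>Convergence of the weighted series of tail probabilities at almost every
  frequency\<close>

theorem theorem3p3:
  fixes P :: "'a measure"
    and X0 :: "'a \<Rightarrow> real"
    and X :: "nat ^ 'd \<Rightarrow> 'a \<Rightarrow> real"
    and M :: real
  assumes "prob_space P"
    and "X0 \<in> borel_measurable P"
    and "\<And>n. n \<in> pos_lattice \<Longrightarrow> X n \<in> borel_measurable P"
    and "M > 0"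
    and "\<And>x n. x \<ge> 0 \<Longrightarrow> n \<in> pos_lattice \<Longrightarrow>
           1 / real (lattice_size n) * (\<Sum>k\<in>lattice_below n. \<P>(\<omega> in P. \<bar>X k \<omega>\<bar> > x))
             \<le> M * \<P>(\<omega> in P. \<bar>X0 \<omega>\<bar> > x)"
    and "integrable P (\<lambda>\<omega>. \<bar>X0 \<omega>\<bar> * log_plus \<bar>X0 \<omega>\<bar> ^ CARD('d))"
  shows "\<forall>\<epsilon>>0. AE t in lebesgue. t \<in> torus \<longrightarrow>
           (\<lambda>n. 1 / real (lattice_size n) *
                \<P>(\<omega> in P. cmod (dft X n t \<omega>) > \<epsilon> * real (lattice_size n)))
             summable_on pos_lattice"
proof (intro allI impI)
  fix \<epsilon> :: real assume \<epsilon>: "\<epsilon> > 0"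
  interpret prob_space P by fact
  note [measurable] = assms(2)
  have X_meas [measurable]: "X k \<in> borel_measurable P" if "k \<in> lattice_below n" for k n
    using assms(3) that by (auto simp: lattice_below_def)

  define N where "N n = lattice_size n" for n :: "nat^'d"
  have N_pos: "real (N n) > 0" if "n \<in> pos_lattice" for n
    using lattice_size_pos[OF that] by (simp add: N_def)
  \<comment> \<open>Common summable majorant, up to constants, for the untruncated tails and for the
    truncated second moments.\<close>
  define q where "q n = expectation (\<lambda>\<omega>. (min 1 ((\<bar>X0 \<omega>\<bar> + 1) / real (N n)))\<^sup>2)" for n
  have q_sum: "q summable_on pos_lattice"
    unfolding q_def N_def by (rule summable_expectation_min_square) (use assms in auto)
  have q_nonneg: "q n \<ge> 0" for n
    unfolding q_def by (rule Bochner_Integration.integral_nonneg) simp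
  have q_int: "integrable P (\<lambda>\<omega>. (min 1 ((\<bar>X0 \<omega>\<bar> + 1) / real (N n)))\<^sup>2)" for n
    by (rule integrable_const_bound[of _ 1]) (auto intro!: AE_I2 power_le_one)

  \<comment> \<open>The truncation level depends on the outer index \<open>n\<close>, so the
    truncated variables form an array indexed by \<open>n\<close> and \<open>k\<close>.\<close>
  define X' where "X' n k \<omega> = X k \<omega> * of_bool (\<bar>X k \<omega>\<bar> \<le> real (N n))" for n k \<omega>
  have X'_meas [measurable]: "X' n k \<in> borel_measurable P" if "k \<in> lattice_below n" for n k
    using that X_meas[OF that] unfolding X'_def by measurable
  have X'_bound: "\<bar>X' n k \<omega>\<bar> \<le> real (N n)" for n k \<omega>
    by (simp add: X'_def)
  define S' where "S' n t \<omega> = (\<Sum>k\<in>lattice_below n. exp (\<i> * complex_of_real (lattice_dot k t)) * complex_of_real (X' n k \<omega>))" for n t \<omega>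
  define h where "h n t = expectation (\<lambda>\<omega>. (cmod (S' n t \<omega>))\<^sup>2)" for n t
  have second_moment: "(\<lambda>t. h n t) \<in> borel_measurable borel"
    "integrable P (\<lambda>\<omega>. (cmod (S' n t \<omega>))\<^sup>2)"
    "(\<integral>\<^sup>+t. ennreal (indicator cube t * h n t) \<partial>lborel) =
      ennreal ((2 * pi) ^ CARD('d) * (\<Sum>k\<in>lattice_below n. expectation (\<lambda>\<omega>. (X' n k \<omega>)\<^sup>2)))" for n t
    unfolding h_def S'_def
    by (intro nn_integral_cube_second_moment[where B = "real (N n)"] finite_lattice_below X'_meas X'_bound; assumption)+
  have S'_meas [measurable]: "S' n t \<in> borel_measurable P" for n t
    unfolding S'_def by measurable
  have h_meas [measurable]: "h n \<in> borel_measurable borel" for n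
    using second_moment(1)[of n] by simp
  have h_nonneg: "h n t \<ge> 0" for n t
    unfolding h_def by (rule Bochner_Integration.integral_nonneg) simp

  \<comment> \<open>The tail assumption at \<open>x = |n|\<close>, together with the fact that the
    minimum inside \<open>q n\<close> equals 1 wherever \<open>|X0|\<close> exceeds
    \<open>N n\<close>.\<close>
  have tail: "1 / real (N n) * (\<Sum>k\<in>lattice_below n. \<P>(\<omega> in P. \<bar>X k \<omega>\<bar> > real (N n))) \<le> M * q n"
    if n: "n \<in> pos_lattice" for n
  proof -
    have "\<P>(\<omega> in P. \<bar>X0 \<omega>\<bar> > real (N n)) = expectation (indicator {\<omega> \<in> space P. \<bar>X0 \<omega>\<bar> > real (N n)})"
      by (subst Bochner_Integration.integral_indicator) (auto intro!: arg_cong[where f = prob])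
    also have "\<dots> \<le> q n"
      unfolding q_def
    proof (rule integral_mono[OF _ q_int])
      show "integrable P (indicator {\<omega> \<in> space P. \<bar>X0 \<omega>\<bar> > real (N n)} :: _ \<Rightarrow> real)"
        by (rule integrable_real_indicator) (auto simp: less_top[symmetric])
      show "indicator {\<omega> \<in> space P. \<bar>X0 \<omega>\<bar> > real (N n)} \<omega> \<le> (min 1 ((\<bar>X0 \<omega>\<bar> + 1) / real (N n)))\<^sup>2" for \<omega>
        using N_pos[OF n] by (auto simp: indicator_def min_def)
    qed
    finally have "M * \<P>(\<omega> in P. \<bar>X0 \<omega>\<bar> > real (N n)) \<le> M * q n"
      using \<open>M > 0\<close> by simp
    with assms(5)[OF _ n, of "real (N n)"] show ?thesis
      by (simp add: N_def)
  qed

  \<comment> \<open>Of the three factors \<open>N n\<close>, one undoes the average over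
    \<open>k\<close>; the other two come from \<open>min N Z = N * min 1 (Z / N)\<close>
    squared.\<close>
  have moment: "(\<Sum>k\<in>lattice_below n. expectation (\<lambda>\<omega>. (X' n k \<omega>)\<^sup>2)) \<le> real (N n) ^ 3 * (M * q n)"
    if n: "n \<in> pos_lattice" for n
  proof -
    have "1 / real (N n) * (\<Sum>k\<in>lattice_below n. expectation (\<lambda>\<omega>. (X' n k \<omega>)\<^sup>2))
      \<le> 1 / real (N n) * (\<Sum>k\<in>lattice_below n. \<Sum>j<N n. (2 * real j + 1) * \<P>(\<omega> in P. \<bar>X k \<omega>\<bar> > real j))"
      unfolding X'_def using N_pos[OF n]
      by (intro mult_left_mono sum_mono truncated_second_moment_le) auto
    also have "\<dots> = (\<Sum>j<N n. (2 * real j + 1) * (1 / real (N n) * (\<Sum>k\<in>lattice_below n. \<P>(\<omega> in P. \<bar>X k \<omega>\<bar> > real j))))"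
      by (subst sum.swap) (simp add: sum_distrib_left mult_ac)
    \<comment> \<open>The tail assumption is used at every integer level \<open>x = j\<close>, with
      \<open>n\<close> fixed.\<close>
    also have "\<dots> \<le> (\<Sum>j<N n. (2 * real j + 1) * (M * \<P>(\<omega> in P. \<bar>X0 \<omega>\<bar> > real j)))"
      unfolding N_def by (intro sum_mono mult_left_mono assms(5) n) auto
    also have "\<dots> = M * (\<Sum>j<N n. (2 * real j + 1) * \<P>(\<omega> in P. \<bar>X0 \<omega>\<bar> > real j))"
      by (simp add: sum_distrib_left mult_ac)
    also have "\<dots> \<le> M * expectation (\<lambda>\<omega>. (min (real (N n)) (\<bar>X0 \<omega>\<bar> + 1))\<^sup>2)"
      using \<open>M > 0\<close> by (intro mult_left_mono sum_odd_prob_le) auto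
    also have "(\<lambda>\<omega>. (min (real (N n)) (\<bar>X0 \<omega>\<bar> + 1))\<^sup>2) = (\<lambda>\<omega>. (real (N n))\<^sup>2 * (min 1 ((\<bar>X0 \<omega>\<bar> + 1) / real (N n)))\<^sup>2)"
      using N_pos[OF n] by (simp add: power_mult_distrib[symmetric] min_mult_distrib_left)
    also have "M * expectation \<dots> = (real (N n))\<^sup>2 * (M * q n)"
      by (simp add: q_def)
    finally show ?thesis
      using N_pos[OF n] by (simp add: field_simps power2_eq_square power3_eq_cube)
  qed

  \<comment> \<open>The weight is the cube of \<open>1 / N n\<close>: one factor from the series,
    two from Chebyshev. It cancels the growth in \<open>moment\<close>, leaving a multiple of
    \<open>q n\<close>.\<close>
  have "AE t in lborel. (\<lambda>n. indicator cube t * h n t / real (N n) ^ 3) summable_on pos_lattice"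
  proof (rule AE_summable_on)
    show "countable (pos_lattice :: (nat^'d) set)" by simp
    show "(\<lambda>t. indicator cube t * h n t / real (N n) ^ 3) \<in> borel_measurable lborel" for n
      by measurable
    show "0 \<le> indicator cube t * h n t / real (N n) ^ 3" for n t
      by (simp add: h_nonneg)
    show "(\<lambda>n. (2 * pi) ^ CARD('d) * (M * q n)) summable_on pos_lattice"
      by (intro summable_on_cmult_right q_sum)
    show "0 \<le> (2 * pi) ^ CARD('d) * (M * q n)" for n
      using \<open>M > 0\<close> by (simp add: q_nonneg)
    fix n :: "nat^'d" assume n: "n \<in> pos_lattice"
    have "(\<integral>\<^sup>+t. ennreal (indicator cube t * h n t / real (N n) ^ 3) \<partial>lborel)
       = (\<integral>\<^sup>+t. ennreal (1 / real (N n) ^ 3) * ennreal (indicator cube t * h n t) \<partial>lborel)"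
      by (simp add: ennreal_mult[symmetric] h_nonneg)
    also have "\<dots> = ennreal (1 / real (N n) ^ 3) * (\<integral>\<^sup>+t. ennreal (indicator cube t * h n t) \<partial>lborel)"
      by (intro nn_integral_cmult) measurable
    also have "\<dots> = ennreal (1 / real (N n) ^ 3 * ((2 * pi) ^ CARD('d) * (\<Sum>k\<in>lattice_below n. expectation (\<lambda>\<omega>. (X' n k \<omega>)\<^sup>2))))"
      unfolding second_moment(3) by (rule ennreal_mult[symmetric]) (auto intro!: sum_nonneg mult_nonneg_nonneg)
    also have "\<dots> \<le> ennreal (1 / real (N n) ^ 3 * ((2 * pi) ^ CARD('d) * (real (N n) ^ 3 * (M * q n))))"
      by (intro ennreal_leI mult_left_mono moment n) auto
    also have "\<dots> = ennreal ((2 * pi) ^ CARD('d) * (M * q n))"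
      using N_pos[OF n] by (simp add: mult_ac)
    finally show "(\<integral>\<^sup>+t. ennreal (indicator cube t * h n t / real (N n) ^ 3) \<partial>lborel) \<le> ennreal ((2 * pi) ^ CARD('d) * (M * q n))" .
  qed
  then have "AE t in lebesgue. (\<lambda>n. indicator cube t * h n t / real (N n) ^ 3) summable_on pos_lattice"
    by (rule AE_completion)
  then show "AE t in lebesgue. t \<in> torus \<longrightarrow>
           (\<lambda>n. 1 / real (lattice_size n) *
                \<P>(\<omega> in P. cmod (dft X n t \<omega>) > \<epsilon> * real (lattice_size n)))
             summable_on pos_lattice"
  proof (eventually_elim, intro impI)
    fix t :: "real^'d"
    assume sum: "(\<lambda>n. indicator cube t * h n t / real (N n) ^ 3) summable_on pos_lattice" and "t \<in> torus"
    then have t: "t \<in> cube" using torus_subset_cube by auto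
    have le: "1 / real (N n) * \<P>(\<omega> in P. cmod (dft X n t \<omega>) > \<epsilon> * real (N n))
      \<le> M * q n + 1 / \<epsilon>\<^sup>2 * (h n t / real (N n) ^ 3)" if n: "n \<in> pos_lattice" for n
    proof -
      let ?A = "\<lambda>k. {\<omega> \<in> space P. \<bar>X k \<omega>\<bar> > real (N n)}"
      \<comment> \<open>Squares and a non-strict inequality match the form of Markov's inequality
        used below.\<close>
      let ?B = "{\<omega> \<in> space P. (cmod (S' n t \<omega>))\<^sup>2 \<ge> (\<epsilon> * real (N n))\<^sup>2}"
      have A_meas: "?A k \<in> sets P" if "k \<in> lattice_below n" for k
        using X_meas[OF that] by measurable
      \<comment> \<open>Outside every \<open>?A k\<close> truncation changes no summand, so the two
        transforms agree and a large value puts \<open>\<omega>\<close> in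
        \<open>?B\<close>.\<close>
      have "{\<omega> \<in> space P. cmod (dft X n t \<omega>) > \<epsilon> * real (N n)} \<subseteq> (\<Union>k\<in>lattice_below n. ?A k) \<union> ?B"
      proof (intro subsetI, rule ccontr)
        fix \<omega> assume \<omega>: "\<omega> \<in> {\<omega> \<in> space P. cmod (dft X n t \<omega>) > \<epsilon> * real (N n)}"
          and no: "\<omega> \<notin> (\<Union>k\<in>lattice_below n. ?A k) \<union> ?B"
        then have "dft X n t \<omega> = S' n t \<omega>"
          unfolding dft_def S'_def X'_def by (intro sum.cong) auto
        with \<omega> have "(\<epsilon> * real (N n))\<^sup>2 \<le> (cmod (S' n t \<omega>))\<^sup>2"
          using \<epsilon> by (intro power_mono) auto
        with no \<omega> show False by auto
      qed
      then have "\<P>(\<omega> in P. cmod (dft X n t \<omega>) > \<epsilon> * real (N n)) \<le> prob ((\<Union>k\<in>lattice_below n. ?A k) \<union> ?B)"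
        using A_meas finite_lattice_below[of n] by (intro finite_measure_mono) (auto intro!: sets.finite_UN)
      also have "\<dots> \<le> prob (\<Union>k\<in>lattice_below n. ?A k) + prob ?B"
        using A_meas finite_lattice_below[of n] by (intro measure_Un_le) (auto intro!: sets.finite_UN)
      \<comment> \<open>Union bound for the first event, Markov's inequality for the squared modulus
        in the second.\<close>
      also have "\<dots> \<le> (\<Sum>k\<in>lattice_below n. prob (?A k)) + h n t / (\<epsilon> * real (N n))\<^sup>2"
        unfolding h_def using A_meas finite_lattice_below[of n] \<epsilon> N_pos[OF n]
        by (intro add_mono finite_measure_subadditive_finite integral_Markov_inequality_measure[where A = "{}"] second_moment(2)) auto
      finally have "1 / real (N n) * \<P>(\<omega> in P. cmod (dft X n t \<omega>) > \<epsilon> * real (N n))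
         \<le> 1 / real (N n) * ((\<Sum>k\<in>lattice_below n. prob (?A k)) + h n t / (\<epsilon> * real (N n))\<^sup>2)"
        by (rule mult_left_mono) simp
      also have "\<dots> = 1 / real (N n) * (\<Sum>k\<in>lattice_below n. prob (?A k)) + 1 / \<epsilon>\<^sup>2 * (h n t / real (N n) ^ 3)"
        by (simp add: distrib_left power_mult_distrib power2_eq_square power3_eq_cube mult_ac)
      finally show ?thesis using tail[OF n] by simp
    qed
    have "(\<lambda>n. M * q n + 1 / \<epsilon>\<^sup>2 * (h n t / real (N n) ^ 3)) summable_on pos_lattice"
      using sum t by (intro summable_on_add summable_on_cmult_right q_sum) simp
    then show "(\<lambda>n. 1 / real (lattice_size n) *
                \<P>(\<omega> in P. cmod (dft X n t \<omega>) > \<epsilon> * real (lattice_size n)))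
             summable_on pos_lattice"
      unfolding N_def[symmetric] by (rule summable_on_comparison_test) (use le in auto)
  qed
qed

end
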